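(* Let $X, Y$ be two metric spaces, and let $f \colon X \to Y$ be a quasisymmetric homeomorphism. Then $\dim_{\rm N} X = \dim_{\rm N} Y$.
   Context: A family $(B_i)_{i\in I}$ of subsets of a metric space $X=(X,d)$ is called $D$-bounded ($D \ge 0$) if $\operatorname{diam} B_i := \sup\{d(x,x') : x,x'\in B_i\} \le D$ for all $i$. For $s>0$, the $s$-multiplicity of the family is the infimum of all integers $n \ge 0$ such that every subset of $X$ with diameter $\le s$ meets at most $n$ members of the family. The Nagata dimension $\dim_{\rm N} X$ of a metric space $X$ is the infimum of all integers $n$ with the following property: there exists a constant $c>0$ such that for all $s>0$, $X$ has a $cs$-bounded covering with $s$-multiplicity at most $n+1$ (the value is $\infty$ if there is no such $n$). A map $f$ from a metric space $X$ into a metric space $Y$ is called quasisymmetric if it is injective and there exists a homeomorphism $\eta \colon [0,\infty) \to [0,\infty)$ such that $d(x,z) \le t\,d(x',z)$ implies $d(f(x),f(z)) \le \eta(t)\,d(f(x'),f(z))$ for all $x,x',z \in X$ and $t>0$. *)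

theory Defs
  imports "HOL-Analysis.Analysis"
begin

text \<open>Metric spaces are values of type \<open>'a metric\<close>, so the carrier may be empty and
  need not be a whole type.\<close>

definition mdiam :: "'a metric \<Rightarrow> 'a set \<Rightarrow> ennreal" where
  "mdiam X A = (SUP (x, x') \<in> A \<times> A. ennreal (mdist X x x'))"

definition bounded_family :: "'a metric \<Rightarrow> real \<Rightarrow> 'i set \<Rightarrow> ('i \<Rightarrow> 'a set) \<Rightarrow> bool" where
  "bounded_family X D I B \<longleftrightarrow>
     0 \<le> D \<and> (\<forall>i\<in>I. B i \<subseteq> mspace X \<and> mdiam X (B i) \<le> ennreal D)"

definition multiplicity_family :: "'a metric \<Rightarrow> real \<Rightarrow> 'i set \<Rightarrow> ('i \<Rightarrow> 'a set) \<Rightarrow> enat" where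
  "multiplicity_family X s I B =
     Inf {enat n | n. \<forall>S. S \<subseteq> mspace X \<and> mdiam X S \<le> ennreal s \<longrightarrow>
                        finite {i\<in>I. S \<inter> B i \<noteq> {}} \<and> card {i\<in>I. S \<inter> B i \<noteq> {}} \<le> n}"

text \<open>In the next definition the index sets range over sets of subsets. This loses no generality:
  any family can be replaced by its set of members, see \<open>multiplicity_family_image_le\<close>.\<close>

definition nagata_property :: "'a metric \<Rightarrow> int \<Rightarrow> bool" where
  "nagata_property X n \<longleftrightarrow>
     (\<exists>c>0::real. \<forall>s>0::real. \<exists>(I :: 'a set set) B.
        bounded_family X (c * s) I B \<and>
        (\<Union>i\<in>I. B i) = mspace X \<and>
        ereal_of_enat (multiplicity_family X s I B) \<le> ereal (real_of_int (n + 1)))"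

text \<open>The infimum is over all integers, in \<open>ereal\<close>: it is \<open>\<infinity>\<close> when no \<open>n\<close> qualifies, and
  the empty space, which has the empty covering of multiplicity 0, gets the value \<open>-1\<close>.\<close>

definition nagata_dim :: "'a metric \<Rightarrow> ereal" where
  "nagata_dim X = Inf {ereal (real_of_int n) | n. nagata_property X n}"

definition quasisymmetric :: "'a metric \<Rightarrow> 'b metric \<Rightarrow> ('a \<Rightarrow> 'b) \<Rightarrow> bool" where
  "quasisymmetric X Y f \<longleftrightarrow>
     f \<in> mspace X \<rightarrow> mspace Y \<and> inj_on f (mspace X) \<and>
     (\<exists>\<eta> :: real \<Rightarrow> real.
        homeomorphic_map (top_of_set {0..}) (top_of_set {0..}) \<eta> \<and>
        (\<forall>x \<in> mspace X. \<forall>x' \<in> mspace X. \<forall>z \<in> mspace X. \<forall>t>0.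
           mdist X x z \<le> t * mdist X x' z \<longrightarrow>
           mdist Y (f x) (f z) \<le> \<eta> t * mdist Y (f x') (f z)))"

lemma multiplicity_family_image_le:
  "multiplicity_family X s (B ` I) (\<lambda>A. A) \<le> multiplicity_family X s I B"
proof -
  have im: "{A \<in> B ` I. S \<inter> A \<noteq> {}} = B ` {i \<in> I. S \<inter> B i \<noteq> {}}" for S
    by auto
  show ?thesis
    unfolding multiplicity_family_def im
    by (rule Inf_superset_mono) (auto intro: le_trans[OF card_image_le])
qed

lemma bounded_family_image:
  "bounded_family X D (B ` I) (\<lambda>A. A) \<longleftrightarrow> bounded_family X D I B"
  by (auto simp: bounded_family_def)

end

theory Submission imports Defs begin

text \<open>
  The Nagata dimension can be read off from colourings: for \<open>N \<ge> 0\<close>, the space \<open>X\<close> has the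
  property with \<open>n = N - 1\<close> iff there is \<open>c > 0\<close> such that at each scale \<open>s\<close> the points can be
  coloured with \<open>N\<close> colours so that every chain of equally coloured points with steps at most \<open>s\<close>
  has its ends within \<open>c * s\<close> (\<open>nagata_property_iff\<close>). In this form no sets have to be
  handled, and changing a covering means changing a function on points.

  A quasisymmetric map \<open>f\<close> sends balls to sets of controlled shape, but the radius of a ball
  with image of size about \<open>s\<close> depends on its centre \<open>x\<close>. Let \<open>\<rho> x\<close> be the supremum of the radii
  for which the image of the ball around \<open>x\<close> has diameter at most \<open>s\<close>; this function is
  1-Lipschitz. If \<open>X\<close> could be coloured so that
  monochromatic chains with steps at most \<open>\<delta> * \<rho> x\<close> near \<open>x\<close> stay within \<open>\<rho> x\<close>, then pushing the
  colours forward by \<open>f\<close> would give a colouring of \<open>Y\<close> at a scale proportional to \<open>s\<close>: chains in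
  \<open>Y\<close> with small steps come from such chains in \<open>X\<close>, by the distortion bound for the inverse, and
  the image of a chain that starts at \<open>x\<close> and stays within \<open>\<rho> x\<close> has diameter at most \<open>s\<close>
  (\<open>linearly_colourable_transfer\<close>).

  The main point is therefore that colourings at every constant scale yield colourings at every
  1-Lipschitz scale function, with the same number of colours (\<open>variable_scale_colouring\<close>). Cut
  \<open>X\<close> into the dyadic level sets of \<open>\<rho>\<close> and colour each level at its own scale. Short steps move
  by at most one level, so levels of the same parity do not interact. The even levels
  are coloured at a much smaller relative scale than the odd ones; an excursion of a chain into
  even levels is then so short that it looks like a single step to the colouring of an odd level.

  Quasisymmetry of \<open>f\<close> enters only through one consequence, shared by \<open>f\<close> and its
  inverse, so that the transfer can be applied in both directions.
\<close>

section \<open>Coverings and monochromatic chains\<close>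

text \<open>The scale may vary from point to point; the condition at both ends makes the relation
  symmetric.\<close>

definition colour_step :: "'a metric \<Rightarrow> ('a \<Rightarrow> nat) \<Rightarrow> ('a \<Rightarrow> real) \<Rightarrow> 'a \<Rightarrow> 'a \<Rightarrow> bool" where
  "colour_step X col \<rho> x y \<longleftrightarrow>
     x \<in> mspace X \<and> y \<in> mspace X \<and> col x = col y \<and> mdist X x y \<le> \<rho> x \<and> mdist X x y \<le> \<rho> y"

definition chain_bounded_colouring :: "'a metric \<Rightarrow> nat \<Rightarrow> real \<Rightarrow> real \<Rightarrow> ('a \<Rightarrow> nat) \<Rightarrow> bool" where
  "chain_bounded_colouring X N D s col \<longleftrightarrow>
     (\<forall>x\<in>mspace X. col x < N) \<and>
     (\<forall>x\<in>mspace X. \<forall>y. (colour_step X col (\<lambda>_. s))\<^sup>*\<^sup>* x y \<longrightarrow> mdist X x y \<le> D)"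

definition linearly_colourable :: "'a metric \<Rightarrow> nat \<Rightarrow> bool" where
  "linearly_colourable X N \<longleftrightarrow>
     (\<exists>c>0. \<forall>s>0. \<exists>col. chain_bounded_colouring X N (c * s) s col)"

lemma colour_step_sym: "colour_step X col \<rho> x y \<Longrightarrow> colour_step X col \<rho> y x"
  by (auto simp: colour_step_def mdist_commute)

lemma colour_chain_sym:
  assumes "(colour_step X col \<rho>)\<^sup>*\<^sup>* x y"
  shows "(colour_step X col \<rho>)\<^sup>*\<^sup>* y x"
  using assms
  by (induction rule: rtranclp_induct)
     (auto intro: converse_rtranclp_into_rtranclp colour_step_sym)

lemma colour_chain_in_mspace:
  assumes "(colour_step X col \<rho>)\<^sup>*\<^sup>* x y" "x \<in> mspace X"
  shows "y \<in> mspace X"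
  using assms by (induction rule: rtranclp_induct) (auto simp: colour_step_def)

lemma colour_chain_same_colour:
  assumes "(colour_step X col \<rho>)\<^sup>*\<^sup>* x y"
  shows "col y = col x"
  using assms by (induction rule: rtranclp_induct) (auto simp: colour_step_def)

lemma mdiam_le_iff:
  assumes "0 \<le> D"
  shows "mdiam X A \<le> ennreal D \<longleftrightarrow> (\<forall>x\<in>A. \<forall>y\<in>A. mdist X x y \<le> D)"
  using assms by (auto simp: mdiam_def SUP_le_iff ennreal_le_iff)

text \<open>The infimum of a nonempty set of extended naturals is attained, so a bound on the
  multiplicity is the same as the bound on the number of members that meet a small set.\<close>

lemma multiplicity_family_le_iff:
  "multiplicity_family X s I B \<le> enat N \<longleftrightarrow>
     (\<forall>S. S \<subseteq> mspace X \<and> mdiam X S \<le> ennreal s \<longrightarrow>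
        finite {i\<in>I. S \<inter> B i \<noteq> {}} \<and> card {i\<in>I. S \<inter> B i \<noteq> {}} \<le> N)"
  (is "?l \<longleftrightarrow> ?P N")
proof
  assume le: ?l
  define M where "M = {enat n | n. ?P n}"
  have Inf_M: "Inf M \<le> enat N"
    using le unfolding multiplicity_family_def M_def .
  hence "M \<noteq> {}"
    by (auto simp: top_enat_def)
  hence "Inf M \<in> M"
    unfolding Inf_enat_def by (auto intro: LeastI)
  then obtain n where n: "Inf M = enat n" "?P n"
    by (auto simp: M_def)
  with Inf_M show "?P N"
    by (auto intro: order_trans)
next
  assume "?P N"
  thus ?l
    unfolding multiplicity_family_def by (intro Inf_lower) blast
qed

lemma increasing_bounded_stationary:
  fixes a :: "nat \<Rightarrow> nat"
  assumes mono: "\<And>m. m < N \<Longrightarrow> a m \<le> a (Suc m)"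
    and "1 \<le> a 0" "a N \<le> N"
  obtains m where "m < N" "a (Suc m) = a m"
proof -
  have "\<exists>m<N. a (Suc m) = a m"
  proof (rule ccontr)
    assume none: "\<not> ?thesis"
    have "m \<le> N \<Longrightarrow> m + 1 \<le> a m" for m
    proof (induction m)
      case 0
      show ?case using assms(2) by simp
    next
      case (Suc m)
      hence "a m < a (Suc m)"
        using mono[of m] none by (metis Suc_le_lessD le_neq_implies_less)
      thus ?case using Suc by simp
    qed
    from this[of N] show False using assms(3) by simp
  qed
  thus ?thesis using that by blast
qed

text \<open>For a point \<open>x\<close> let \<open>K m x\<close> be the set of members that come within \<open>m * s\<close> of \<open>x\<close>. The sets
  \<open>K 0 x \<subseteq> \<dots> \<subseteq> K N x\<close> have between \<open>1\<close> and \<open>N\<close> elements, as they all meet the ball of radius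
  \<open>N * s\<close>; hence two successive ones agree, and \<open>x\<close> is coloured by the cardinality of their common
  value \<open>L x\<close>. A step of length \<open>s\<close> loses at most one unit of \<open>m\<close>, which the repetition in \<open>L\<close>
  absorbs: for points at distance at most \<open>s\<close> the sets \<open>L\<close> are comparable, and if they have the
  same cardinality, they are equal. So \<open>L\<close> is constant along monochromatic chains, and the
  ends of a chain are close to the same member of the covering.\<close>

lemma colouring_of_covering:
  assumes bounded: "\<And>i x y. i \<in> I \<Longrightarrow> x \<in> B i \<Longrightarrow> y \<in> B i \<Longrightarrow> mdist X x y \<le> D"
    and sub: "\<And>i. i \<in> I \<Longrightarrow> B i \<subseteq> mspace X"
    and cover: "(\<Union>i\<in>I. B i) = mspace X"
    and mult: "multiplicity_family X (2 * real N * s) I B \<le> enat N"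
    and s: "s > 0"
  shows "\<exists>col. chain_bounded_colouring X N (D + 2 * real N * s) s col"
proof -
  define K where "K m x = {i\<in>I. \<exists>b\<in>B i. mdist X x b \<le> real m * s}" for m x
  have K_mono: "K m x \<subseteq> K m' x" if "m \<le> m'" for m m' x
    using that s by (fastforce simp: K_def intro: order_trans mult_right_mono)
  have K_near: "K m x \<subseteq> K (Suc m) y"
    if "x \<in> mspace X" "y \<in> mspace X" "mdist X x y \<le> s" for m x y
  proof
    fix i assume "i \<in> K m x"
    then obtain b where b: "i \<in> I" "b \<in> B i" "mdist X x b \<le> real m * s"
      by (auto simp: K_def)
    have "mdist X y b \<le> mdist X y x + mdist X x b"
      using b sub that by (intro mdist_triangle) auto
    also have "\<dots> \<le> real (Suc m) * s"
      using b that by (simp add: mdist_commute algebra_simps)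
    finally show "i \<in> K (Suc m) y"
      using b by (auto simp: K_def)
  qed
  have K_fin: "finite (K N x) \<and> card (K N x) \<le> N" if x: "x \<in> mspace X" for x
  proof -
    define S where "S = {y\<in>mspace X. mdist X x y \<le> real N * s}"
    have "mdist X y z \<le> 2 * real N * s" if "y \<in> S" "z \<in> S" for y z
      using that x mdist_triangle[of y X x z] by (auto simp: S_def mdist_commute)
    hence "mdiam X S \<le> ennreal (2 * real N * s)"
      using s by (subst mdiam_le_iff) auto
    hence *: "finite {i\<in>I. S \<inter> B i \<noteq> {}} \<and> card {i\<in>I. S \<inter> B i \<noteq> {}} \<le> N"
      using mult unfolding multiplicity_family_le_iff by (auto simp: S_def)
    have "K N x = {i\<in>I. S \<inter> B i \<noteq> {}}"
      using sub by (fastforce simp: K_def S_def)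
    thus ?thesis using * by simp
  qed
  have "\<exists>m<N. K (Suc m) x = K m x" if x: "x \<in> mspace X" for x
  proof -
    have fin: "finite (K m x)" if "m \<le> N" for m
      using K_mono[OF that, of x] K_fin[OF x] finite_subset by blast
    obtain i where "i \<in> I" "x \<in> B i"
      using cover x by blast
    moreover have "mdist X x x = 0"
      using x by simp
    ultimately have "i \<in> K 0 x"
      unfolding K_def by (intro CollectI conjI bexI[of _ x]) auto
    hence "1 \<le> card (K 0 x)"
      using fin[of 0] by (metis One_nat_def Suc_leI card_gt_0_iff empty_iff le0)
    then obtain m where "m < N" "card (K (Suc m) x) = card (K m x)"
      using increasing_bounded_stationary[of N "\<lambda>m. card (K m x)"] K_fin[OF x]
        card_mono[OF fin K_mono] by (metis Suc_leI le_SucI order_refl)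
    moreover from this have "K m x = K (Suc m) x"
      by (intro card_subset_eq fin K_mono) auto
    ultimately show ?thesis by metis
  qed
  then obtain m where m: "\<And>x. x \<in> mspace X \<Longrightarrow> m x < N \<and> K (Suc (m x)) x = K (m x) x"
    by metis
  define L where "L x = K (m x) x" for x
  have L_sub: "L x \<subseteq> K N x" if "x \<in> mspace X" for x
    unfolding L_def using m[OF that] by (intro K_mono) auto
  have L_fin: "finite (L x)" "card (L x) \<le> N" if "x \<in> mspace X" for x
    using L_sub[OF that] K_fin[OF that] card_mono finite_subset order_trans by metis+
  have L_ne: "L x \<noteq> {}" if x: "x \<in> mspace X" for x
  proof -
    obtain i where "i \<in> I" "x \<in> B i"
      using cover x by blast
    moreover have "mdist X x x = 0"
      using x by simp
    ultimately have "i \<in> L x"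
      using s unfolding L_def K_def by (intro CollectI conjI bexI[of _ x]) auto
    thus ?thesis by blast
  qed
  have L_comparable: "L x \<subseteq> L y"
    if "x \<in> mspace X" "y \<in> mspace X" "mdist X x y \<le> s" "m x \<le> m y" for x y
  proof -
    have "K (m x) x \<subseteq> K (Suc (m x)) y"
      using K_near that by blast
    also have "\<dots> \<subseteq> K (Suc (m y)) y"
      using that by (intro K_mono) auto
    also have "\<dots> = K (m y) y"
      using m that by blast
    finally show ?thesis by (simp add: L_def)
  qed
  define col where "col x = card (L x) - 1" for x
  have card_pos: "card (L x) \<ge> 1" if "x \<in> mspace X" for x
    using L_ne[OF that] L_fin[OF that] by (simp add: Suc_leI card_gt_0_iff)
  have step: "L y = L x" if "colour_step X col (\<lambda>_. s) x y" for x y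
  proof -
    have xy: "x \<in> mspace X" "y \<in> mspace X" "mdist X x y \<le> s" "mdist X y x \<le> s"
      and "card (L x) = card (L y)"
      using that card_pos[of x] card_pos[of y]
      by (auto simp: colour_step_def col_def mdist_commute)
    thus ?thesis
      using L_comparable[of x y] L_comparable[of y x] L_fin card_subset_eq
      by (metis nat_le_linear)
  qed
  have "mdist X x y \<le> D + 2 * real N * s"
    if x: "x \<in> mspace X" and chain: "(colour_step X col (\<lambda>_. s))\<^sup>*\<^sup>* x y" for x y
  proof -
    have y: "y \<in> mspace X"
      using colour_chain_in_mspace chain x by metis
    have "L y = L x"
      using chain by (induction rule: rtranclp_induct) (auto dest: step)
    then obtain i where "i \<in> K N x" "i \<in> K N y"
      using L_ne[OF x] L_sub[OF x] L_sub[OF y] by blast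
    then obtain a b where ab: "i \<in> I" "a \<in> B i" "b \<in> B i"
        "mdist X x a \<le> real N * s" "mdist X y b \<le> real N * s"
      by (auto simp: K_def)
    hence ab': "a \<in> mspace X" "b \<in> mspace X" "mdist X a b \<le> D"
      using sub bounded by auto
    have "mdist X x y \<le> mdist X x a + mdist X a y"
      "mdist X a y \<le> mdist X a b + mdist X b y"
      using x y ab' by (auto intro: mdist_triangle)
    thus ?thesis
      using ab ab' by (simp add: mdist_commute)
  qed
  moreover have "col x < N" if "x \<in> mspace X" for x
    using card_pos[OF that] L_fin[OF that] by (simp add: col_def)
  ultimately show ?thesis
    unfolding chain_bounded_colouring_def by blast
qed

text \<open>The covering consists of the chain components. Two components of the same colour cannot
  both meet a set of diameter \<open>s\<close>, since a point of one and a point of the other would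
  be joined by a step.\<close>

lemma covering_of_colouring:
  fixes X :: "'a metric"
  assumes col: "chain_bounded_colouring X N D s col" and D: "D \<ge> 0" and s: "s > 0"
  obtains I :: "'a set set"
  where "bounded_family X D I (\<lambda>A. A)" "(\<Union>A\<in>I. A) = mspace X"
    "multiplicity_family X s I (\<lambda>A. A) \<le> enat N"
proof -
  let ?R = "(colour_step X col (\<lambda>_. s))\<^sup>*\<^sup>*"
  define cell where "cell x = {y. ?R x y}" for x
  define I where "I = cell ` mspace X"
  have cell_eq: "cell x = cell y" if "?R x y" for x y
    using that colour_chain_sym[OF that] by (auto simp: cell_def intro: rtranclp_trans)
  have cell_sub: "cell x \<subseteq> mspace X" if "x \<in> mspace X" for x
    using that by (auto simp: cell_def intro: colour_chain_in_mspace)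
  have "mdist X y z \<le> D" if "x \<in> mspace X" "y \<in> cell x" "z \<in> cell x" for x y z
  proof -
    have "?R y z"
      using that by (auto simp: cell_def intro: rtranclp_trans colour_chain_sym)
    thus ?thesis
      using col cell_sub that unfolding chain_bounded_colouring_def by blast
  qed
  hence "bounded_family X D I (\<lambda>A. A)"
    unfolding bounded_family_def mdiam_le_iff[OF D] using cell_sub D by (auto simp: I_def)
  moreover have "(\<Union>A\<in>I. A) = mspace X"
    using cell_sub by (auto simp: I_def cell_def)
  moreover have "multiplicity_family X s I (\<lambda>A. A) \<le> enat N"
    unfolding multiplicity_family_le_iff
  proof (intro allI impI)
    fix S assume S: "S \<subseteq> mspace X \<and> mdiam X S \<le> ennreal s"
    hence diam: "mdist X x y \<le> s" if "x \<in> S" "y \<in> S" for x y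
      using that s mdiam_le_iff[of s X S] by auto
    define J where "J = {A\<in>I. S \<inter> A \<noteq> {}}"
    have "\<exists>x\<in>S. A = cell x" if A: "A \<in> J" for A
    proof -
      obtain x y where "A = cell x" "y \<in> S" "y \<in> A"
        using A unfolding J_def I_def by blast
      thus ?thesis
        using cell_eq[of x y] by (auto simp: cell_def)
    qed
    then obtain p where p: "\<And>A. A \<in> J \<Longrightarrow> p A \<in> S \<and> A = cell (p A)"
      by metis
    have same: "cell x = cell y" if "x \<in> S" "y \<in> S" "col x = col y" for x y
      using that S diam
      by (intro cell_eq r_into_rtranclp) (auto simp: colour_step_def subset_iff)
    define h where "h A = col (p A)" for A
    have inj: "inj_on h J"
    proof (rule inj_onI)
      fix A A' assume A: "A \<in> J" "A' \<in> J" "h A = h A'"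
      hence "cell (p A) = cell (p A')"
        using p by (intro same) (auto simp: h_def)
      thus "A = A'" using p A by simp
    qed
    have "h ` J \<subseteq> {..<N}"
      using p S col by (fastforce simp: h_def chain_bounded_colouring_def)
    hence "finite J \<and> card J \<le> N"
      using inj by (metis card_inj_on_le card_lessThan finite_lessThan inj_on_finite)
    thus "finite {A\<in>I. S \<inter> A \<noteq> {}} \<and> card {A\<in>I. S \<inter> A \<noteq> {}} \<le> N"
      by (simp add: J_def)
  qed
  ultimately show ?thesis by (rule that)
qed

text \<open>The lower bound on \<open>n\<close> expresses that a multiplicity is never negative. For \<open>n = -1\<close> both
  sides say that the space is empty.\<close>

lemma nagata_property_iff:
  fixes X :: "'a metric"
  shows "nagata_property X n \<longleftrightarrow> -1 \<le> n \<and> linearly_colourable X (nat (n + 1))"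
proof
  assume "nagata_property X n"
  then obtain c :: real where c: "c > 0" and cov: "\<And>s. s > 0 \<Longrightarrow> \<exists>(I :: 'a set set) B.
        bounded_family X (c * s) I B \<and> (\<Union>i\<in>I. B i) = mspace X \<and>
        ereal_of_enat (multiplicity_family X s I B) \<le> ereal (real_of_int (n + 1))"
    unfolding nagata_property_def by blast
  define N where "N = nat (n + 1)"
  have "0 \<le> ereal (real_of_int (n + 1))"
    using cov[of 1] by (metis ereal_of_enat_nonneg order_trans zero_less_one)
  hence n: "-1 \<le> n" by simp
  hence N: "ereal (real_of_int (n + 1)) = ereal_of_enat (enat N)"
    by (simp add: N_def)
  have "\<exists>col. chain_bounded_colouring X N ((c + 1) * (2 * real N + 1) * s) s col" if s: "s > 0" for s
  proof -
    let ?s = "(2 * real N + 1) * s"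
    have "?s > 0" using s by (simp add: add_nonneg_pos)
    from cov[OF this] obtain I :: "'a set set" and B where
      I: "bounded_family X (c * ?s) I B" "(\<Union>i\<in>I. B i) = mspace X"
        "multiplicity_family X ?s I B \<le> enat N"
      unfolding N ereal_of_enat_le_iff by blast
    have D: "0 \<le> c * ?s" using I(1) by (simp add: bounded_family_def)
    have "ennreal (2 * real N * s) \<le> ennreal ?s"
      using s by (intro ennreal_leI) (auto simp: algebra_simps)
    hence "multiplicity_family X (2 * real N * s) I B \<le> enat N"
      using I(3) unfolding multiplicity_family_le_iff by (meson order_trans)
    hence "\<exists>col. chain_bounded_colouring X N (c * ?s + 2 * real N * s) s col"
      using I s unfolding bounded_family_def mdiam_le_iff[OF D]
      by (intro colouring_of_covering[of I B]) auto
    moreover have "c * ?s + 2 * real N * s \<le> (c + 1) * (2 * real N + 1) * s"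
      using s by (simp add: algebra_simps)
    ultimately show ?thesis
      unfolding chain_bounded_colouring_def by (meson order_trans)
  qed
  moreover have "(c + 1) * (2 * real N + 1) > 0"
    using c by (simp add: add_nonneg_pos)
  ultimately show "-1 \<le> n \<and> linearly_colourable X (nat (n + 1))"
    using n unfolding linearly_colourable_def N_def[symmetric] by blast
next
  define N where "N = nat (n + 1)"
  assume "-1 \<le> n \<and> linearly_colourable X (nat (n + 1))"
  hence N: "ereal (real_of_int (n + 1)) = ereal_of_enat (enat N)" and "linearly_colourable X N"
    by (simp_all add: N_def)
  then obtain c where c: "c > 0" "\<And>s. s > 0 \<Longrightarrow> \<exists>col. chain_bounded_colouring X N (c * s) s col"
    unfolding linearly_colourable_def by blast
  have "\<exists>(I :: 'a set set) B. bounded_family X (c * s) I B \<and> (\<Union>i\<in>I. B i) = mspace X \<and>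
        ereal_of_enat (multiplicity_family X s I B) \<le> ereal (real_of_int (n + 1))" if s: "s > 0" for s
  proof -
    obtain col where "chain_bounded_colouring X N (c * s) s col"
      using c(2)[OF s] by blast
    from covering_of_colouring[OF this _ s] c(1) s show ?thesis
      unfolding N ereal_of_enat_le_iff by (metis less_imp_le mult_pos_pos)
  qed
  thus "nagata_property X n"
    unfolding nagata_property_def using c(1) by blast
qed

section \<open>Colourings at a variable scale\<close>

abbreviation level :: "real \<Rightarrow> int" where
  "level r \<equiv> \<lfloor>log 2 r\<rfloor>"

lemma level_bounds:
  assumes "r > 0"
  shows "2 powr level r \<le> r" "r < 2 * 2 powr level r"
proof -
  have *: "2 powr log 2 r = r" using assms by simp
  have "2 powr level r \<le> 2 powr log 2 r"
    by (intro powr_mono) auto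
  thus "2 powr level r \<le> r" by (simp only: *)
  have "2 powr log 2 r < 2 powr (1 + level r)"
    by (intro powr_less_mono) linarith+
  also have "\<dots> = 2 * 2 powr level r" by (simp add: powr_add)
  finally show "r < 2 * 2 powr level r" by (simp only: *)
qed

lemma level_eqI:
  assumes "a > 0" "b > 0" "a \<le> 2 * b" "b \<le> 2 * a" "even (level a) \<longleftrightarrow> even (level b)"
  shows "level a = level b"
proof -
  have aux: "level u \<le> 1 + level v" if "u > 0" "v > 0" "u \<le> 2 * v" for u v :: real
  proof -
    have "log 2 u \<le> log 2 (2 * v)"
      using that by simp
    also have "\<dots> = 1 + log 2 v"
      using that by (simp add: log_mult)
    finally show ?thesis by linarith
  qed
  have "i = j" if "i \<le> 1 + j" "j \<le> 1 + i" "even i \<longleftrightarrow> even j" for i j :: int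
    using that by presburger
  thus ?thesis
    using aux[of a b] aux[of b a] assms by blast
qed

text \<open>A step of relative length \<open>\<epsilon> \<le> 1\<close> changes \<open>\<rho>\<close> by a factor of at most \<open>2\<close>, hence the level by
  at most one. A chain among levels of one parity therefore never leaves its level, where it is a
  monochromatic chain at a constant scale. This scale is \<open>2 * \<epsilon> * 2 powr j\<close> because
  \<open>\<rho> x < 2 * 2 powr j\<close> on level \<open>j\<close>.\<close>

lemma same_parity_chain:
  assumes pos: "\<And>x. x \<in> mspace X \<Longrightarrow> \<rho> x > 0"
    and lip: "\<And>x y. x \<in> mspace X \<Longrightarrow> y \<in> mspace X \<Longrightarrow> \<rho> x \<le> \<rho> y + mdist X x y"
    and \<epsilon>: "0 < \<epsilon>" "\<epsilon> \<le> 1"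
    and \<kappa>: "\<And>j. even j = p \<Longrightarrow>
      chain_bounded_colouring X N (c * (2 * \<epsilon> * 2 powr real_of_int j)) (2 * \<epsilon> * 2 powr real_of_int j) (\<kappa> j)"
    and col: "\<And>x. col x = \<kappa> (level (\<rho> x)) x"
    and x: "x \<in> mspace X" "even (level (\<rho> x)) = p"
    and chain: "(\<lambda>x y. colour_step X col (\<lambda>x. \<epsilon> * \<rho> x) x y \<and>
                   even (level (\<rho> x)) = p \<and> even (level (\<rho> y)) = p)\<^sup>*\<^sup>* x y"
    and c: "c > 0"
  shows "level (\<rho> y) = level (\<rho> x)" "mdist X x y \<le> 2 * c * \<epsilon> * \<rho> x"
proof -
  let ?s = "2 * \<epsilon> * 2 powr level (\<rho> x)"
  have *: "level (\<rho> y) = level (\<rho> x) \<and> (colour_step X (\<kappa> (level (\<rho> x))) (\<lambda>_. ?s))\<^sup>*\<^sup>* x y"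
    using chain
  proof (induction rule: rtranclp_induct)
    case base
    show ?case by simp
  next
    case (step y z)
    hence yz: "y \<in> mspace X" "z \<in> mspace X" "col y = col z"
        "mdist X y z \<le> \<epsilon> * \<rho> y" "mdist X y z \<le> \<epsilon> * \<rho> z"
      by (auto simp: colour_step_def)
    have "\<epsilon> * \<rho> y \<le> \<rho> y" "\<epsilon> * \<rho> z \<le> \<rho> z"
      using \<epsilon> pos yz by (auto intro!: mult_left_le_one_le less_imp_le)
    hence "\<rho> y \<le> 2 * \<rho> z" "\<rho> z \<le> 2 * \<rho> y"
      using yz lip[of y z] lip[of z y] mdist_commute[of X y z] by linarith+
    hence lev: "level (\<rho> y) = level (\<rho> z)"
      using step pos yz by (intro level_eqI) auto
    have "\<epsilon> * \<rho> y \<le> \<epsilon> * (2 * 2 powr level (\<rho> y))"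
      using level_bounds[OF pos[OF yz(1)]] \<epsilon> by (intro mult_left_mono) auto
    hence "mdist X y z \<le> ?s"
      using yz step lev by (simp add: mult_ac)
    hence "colour_step X (\<kappa> (level (\<rho> x))) (\<lambda>_. ?s) y z"
      using yz step lev col[of y] col[of z] by (auto simp: colour_step_def)
    thus ?case
      using step lev by auto
  qed
  thus "level (\<rho> y) = level (\<rho> x)" by blast
  have "mdist X x y \<le> c * ?s"
    using * \<kappa>[OF x(2)] x(1) unfolding chain_bounded_colouring_def by blast
  also have "\<dots> = 2 * c * \<epsilon> * 2 powr level (\<rho> x)" by simp
  also have "\<dots> \<le> 2 * c * \<epsilon> * \<rho> x"
    using level_bounds[OF pos[OF x(1)]] c \<epsilon> by (intro mult_left_mono) auto
  finally show "mdist X x y \<le> 2 * c * \<epsilon> * \<rho> x" .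
qed

text \<open>A 1-Lipschitz scale function is coloured level by level, with relative scale \<open>\<delta>\<close> on even
  levels and \<open>\<epsilon>\<close> on odd ones. The constant \<open>\<delta>\<close> depends on the space alone, not on the scale
  function; this is what makes the result of the transfer linear in the scale.\<close>

lemma variable_scale_colouring:
  assumes "linearly_colourable X N"
  obtains \<delta> where "\<delta> > 0"
    "\<And>\<rho>. (\<And>x. x \<in> mspace X \<Longrightarrow> \<rho> x > 0) \<Longrightarrow>
      (\<And>x y. x \<in> mspace X \<Longrightarrow> y \<in> mspace X \<Longrightarrow> \<rho> x \<le> \<rho> y + mdist X x y) \<Longrightarrow>
      \<exists>col. (\<forall>x\<in>mspace X. col x < N) \<and>
        (\<forall>x\<in>mspace X. \<forall>y. (colour_step X col (\<lambda>x. \<delta> * \<rho> x))\<^sup>*\<^sup>* x y \<longrightarrow> mdist X x y < \<rho> x)"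
proof -
  obtain c' where "c' > 0"
    and c': "\<And>s. s > 0 \<Longrightarrow> \<exists>col. chain_bounded_colouring X N (c' * s) s col"
    using assms unfolding linearly_colourable_def by blast
  define c where "c = max c' 1"
  have c1: "c \<ge> 1" and c0: "c > 0" by (simp_all add: c_def)
  have colX: "\<exists>col. chain_bounded_colouring X N (c * s) s col" if "s > 0" for s
  proof -
    have "c' * s \<le> c * s" using that by (simp add: c_def)
    thus ?thesis
      using c'[OF that] unfolding chain_bounded_colouring_def by (meson order_trans)
  qed
  \<comment> \<open>Chosen so that the final bound \<open>32 * c\<^sup>2 * \<delta> + 8 * c * \<delta> + 2 * \<delta>\<close> is at most \<open>1 / 4\<close>.\<close>
  define \<delta> where "\<delta> = 1 / (168 * c\<^sup>2)"
  have \<delta>: "\<delta> > 0" and \<delta>c: "c\<^sup>2 * \<delta> = 1 / 168"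
    using c1 by (simp_all add: \<delta>_def)
  have "c * 1 \<le> c * c" using c1 by (intro mult_left_mono) auto
  hence cc: "c \<le> c\<^sup>2" by (simp add: power2_eq_square)
  hence "c * \<delta> \<le> c\<^sup>2 * \<delta>"
    using \<delta> by (intro mult_right_mono) auto
  hence c\<delta>: "c * \<delta> \<le> 1 / 168" by (simp only: \<delta>c)
  have \<delta>1: "\<delta> \<le> c * \<delta>" using c1 \<delta> by simp
  have \<delta>_le: "\<delta> \<le> 1" using \<delta>1 c\<delta> by simp
  \<comment> \<open>Large enough to cover, relative to \<open>\<rho>\<close> at an odd end, an excursion into even levels: a step
    into them, a chain of length \<open>2 * c * \<delta> * \<rho>\<close> inside, and a step out.\<close>
  define \<epsilon> where "\<epsilon> = 16 * c * \<delta>"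
  have \<epsilon>: "0 < \<epsilon>" "\<epsilon> \<le> 1" using c1 \<delta> c\<delta> by (auto simp: \<epsilon>_def)
  have "\<exists>col. (\<forall>x\<in>mspace X. col x < N) \<and>
        (\<forall>x\<in>mspace X. \<forall>y. (colour_step X col (\<lambda>x. \<delta> * \<rho> x))\<^sup>*\<^sup>* x y \<longrightarrow> mdist X x y < \<rho> x)"
    if pos: "\<And>x. x \<in> mspace X \<Longrightarrow> \<rho> x > 0"
      and lip: "\<And>x y. x \<in> mspace X \<Longrightarrow> y \<in> mspace X \<Longrightarrow> \<rho> x \<le> \<rho> y + mdist X x y" for \<rho>
  proof -
    define sc :: "int \<Rightarrow> real" where "sc j = 2 * (if even j then \<delta> else \<epsilon>) * 2 powr real_of_int j" for j
    have "sc j > 0" for j using \<delta> \<epsilon> by (simp add: sc_def)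
    hence "\<forall>j. \<exists>col. chain_bounded_colouring X N (c * sc j) (sc j) col"
      using colX by blast
    then obtain \<kappa> where \<kappa>: "\<And>j. chain_bounded_colouring X N (c * sc j) (sc j) (\<kappa> j)"
      by metis
    define col where "col x = \<kappa> (level (\<rho> x)) x" for x
    define E where "E x \<longleftrightarrow> even (level (\<rho> x))" for x
    define S where "S = colour_step X col (\<lambda>x. \<delta> * \<rho> x)"
    define SE where "SE x y \<longleftrightarrow> S x y \<and> E x \<and> E y" for x y
    define SO where "SO x y \<longleftrightarrow> colour_step X col (\<lambda>x. \<epsilon> * \<rho> x) x y \<and> \<not> E x \<and> \<not> E y" for x y
    have even_chain: "level (\<rho> y) = level (\<rho> x) \<and> mdist X x y \<le> 2 * c * \<delta> * \<rho> x"
      if "SE\<^sup>*\<^sup>* x y" "x \<in> mspace X" "E x" for x y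
    proof (intro conjI)
      have scale: "chain_bounded_colouring X N (c * (2 * \<delta> * 2 powr real_of_int j))
          (2 * \<delta> * 2 powr real_of_int j) (\<kappa> j)" if "even j = True" for j
        using \<kappa>[of j] that by (simp add: sc_def)
      have lev: "even (level (\<rho> x)) = True"
        and chain: "(\<lambda>x y. colour_step X col (\<lambda>x. \<delta> * \<rho> x) x y \<and>
             even (level (\<rho> x)) = True \<and> even (level (\<rho> y)) = True)\<^sup>*\<^sup>* x y"
        using that by (simp_all add: SE_def[abs_def] S_def E_def)
      note * = same_parity_chain[OF pos lip \<delta> \<delta>_le scale col_def that(2) lev chain c0]
      show "level (\<rho> y) = level (\<rho> x)" "mdist X x y \<le> 2 * c * \<delta> * \<rho> x"
        by (rule *; assumption)+
    qed
    have odd_chain: "level (\<rho> y) = level (\<rho> x) \<and> mdist X x y \<le> 2 * c * \<epsilon> * \<rho> x"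
      if "SO\<^sup>*\<^sup>* x y" "x \<in> mspace X" "\<not> E x" for x y
    proof (intro conjI)
      have scale: "chain_bounded_colouring X N (c * (2 * \<epsilon> * 2 powr real_of_int j))
          (2 * \<epsilon> * 2 powr real_of_int j) (\<kappa> j)" if "even j = False" for j
        using \<kappa>[of j] that by (simp add: sc_def)
      have lev: "even (level (\<rho> x)) = False"
        and chain: "(\<lambda>x y. colour_step X col (\<lambda>x. \<epsilon> * \<rho> x) x y \<and>
             even (level (\<rho> x)) = False \<and> even (level (\<rho> y)) = False)\<^sup>*\<^sup>* x y"
        using that by (simp_all add: SO_def[abs_def] E_def)
      note * = same_parity_chain[OF pos lip \<epsilon> scale col_def that(2) lev chain c0]
      show "level (\<rho> y) = level (\<rho> x)" "mdist X x y \<le> 2 * c * \<epsilon> * \<rho> x"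
        by (rule *; assumption)+
    qed
    have S_D: "x \<in> mspace X" "y \<in> mspace X" "col x = col y"
        "mdist X x y \<le> \<delta> * \<rho> x" "mdist X x y \<le> \<delta> * \<rho> y" "\<rho> x \<le> 2 * \<rho> y" "\<rho> y \<le> 2 * \<rho> x"
      if "S x y" for x y
    proof -
      show *: "x \<in> mspace X" "y \<in> mspace X" "col x = col y"
        "mdist X x y \<le> \<delta> * \<rho> x" "mdist X x y \<le> \<delta> * \<rho> y"
        using that by (auto simp: S_def colour_step_def)
      have "\<delta> * \<rho> x \<le> \<rho> x" "\<delta> * \<rho> y \<le> \<rho> y"
        using \<delta>_le pos[OF *(1)] pos[OF *(2)] by auto
      thus "\<rho> x \<le> 2 * \<rho> y" "\<rho> y \<le> 2 * \<rho> x"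
        using * lip[of x y] lip[of y x] by (auto simp: mdist_commute)
    qed
    have SE_S: "S\<^sup>*\<^sup>* x y" if "SE\<^sup>*\<^sup>* x y" for x y
      using that by (rule rtranclp_mono[THEN predicate2D, rotated]) (auto simp: SE_def)
    have same_level: "\<rho> y \<le> 2 * \<rho> x"
      if "level (\<rho> y) = level (\<rho> x)" "x \<in> mspace X" "y \<in> mspace X" for x y
      using level_bounds[OF pos[OF that(2)]] level_bounds[OF pos[OF that(3)]] that(1) by simp
    have detour: "SO o1 o2"
      if "S o1 e1" "SE\<^sup>*\<^sup>* e1 e2" "S e2 o2" "\<not> E o1" "\<not> E o2" "E e1" for o1 e1 e2 o2
    proof -
      note 1 = S_D[OF that(1)] and 2 = S_D[OF that(3)]
      have ee: "level (\<rho> e2) = level (\<rho> e1)" "mdist X e1 e2 \<le> 2 * c * \<delta> * \<rho> e1"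
        using even_chain[OF that(2) 1(2) that(6)] by auto
      have "\<rho> e2 \<le> 2 * \<rho> e1" "\<rho> e1 \<le> 2 * \<rho> e2"
        using same_level ee(1) 1 2 by auto
      hence \<rho>: "\<rho> e1 \<le> 4 * \<rho> o2" "\<rho> e2 \<le> 4 * \<rho> o1"
        using 1 2 by linarith+
      have "mdist X o1 o2 \<le> mdist X o1 e1 + mdist X e1 o2" "mdist X e1 o2 \<le> mdist X e1 e2 + mdist X e2 o2"
        using 1 2 by (auto intro: mdist_triangle)
      hence d: "mdist X o1 o2 \<le> mdist X o1 e1 + 2 * c * \<delta> * \<rho> e1 + mdist X e2 o2"
        using ee by linarith
      have c\<delta>0: "0 \<le> 2 * c * \<delta>" and \<delta>0: "0 \<le> \<delta>"
        using c1 \<delta> by simp_all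
      have small: "\<delta> * r \<le> c * \<delta> * r" "0 \<le> c * \<delta> * r" if "r > 0" for r
        using \<delta>1 c1 \<delta> that by (auto intro: mult_right_mono)
      have "mdist X o1 o2 \<le> \<epsilon> * \<rho> o1"
      proof -
        have "2 * c * \<delta> * \<rho> e1 \<le> 2 * c * \<delta> * (2 * \<rho> o1)"
          using 1(7) c\<delta>0 by (rule mult_left_mono)
        moreover have "\<delta> * \<rho> e2 \<le> \<delta> * (4 * \<rho> o1)"
          using \<rho>(2) \<delta>0 by (rule mult_left_mono)
        ultimately show ?thesis
          using d 1(4) 2(4) small[OF pos[OF 1(1)]] unfolding \<epsilon>_def by linarith
      qed
      moreover have "mdist X o1 o2 \<le> \<epsilon> * \<rho> o2"
      proof -
        have "2 * c * \<delta> * \<rho> e1 \<le> 2 * c * \<delta> * (4 * \<rho> o2)"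
          using \<rho>(1) c\<delta>0 by (rule mult_left_mono)
        moreover have "\<delta> * \<rho> e1 \<le> \<delta> * (4 * \<rho> o2)"
          using \<rho>(1) \<delta>0 by (rule mult_left_mono)
        ultimately show ?thesis
          using d 1(5) 2(5) small[OF pos[OF 2(2)]] unfolding \<epsilon>_def by linarith
      qed
      moreover have "col e2 = col e1"
        using SE_S[OF that(2)] unfolding S_def by (rule colour_chain_same_colour)
      ultimately show ?thesis
        using 1 2 that by (auto simp: SO_def colour_step_def)
    qed
    have direct: "SO x y" if "S x y" "\<not> E x" "\<not> E y" for x y
    proof -
      note xy = S_D[OF that(1)]
      have "\<delta> \<le> \<epsilon>" using \<delta>1 c1 \<delta> by (simp add: \<epsilon>_def)
      hence "\<delta> * \<rho> x \<le> \<epsilon> * \<rho> x" "\<delta> * \<rho> y \<le> \<epsilon> * \<rho> y"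
        using pos[OF xy(1)] pos[OF xy(2)] by auto
      thus ?thesis using xy that by (auto simp: SO_def colour_step_def)
    qed
    \<comment> \<open>A chain from an odd level is followed by its last odd point \<open>w\<close>, with at most one
      unfinished excursion after it.\<close>
    have from_odd: "\<exists>w. SO\<^sup>*\<^sup>* x w \<and> \<not> E w \<and> (w = y \<or> (\<exists>e. E e \<and> E y \<and> S w e \<and> SE\<^sup>*\<^sup>* e y))"
      if "S\<^sup>*\<^sup>* x y" "\<not> E x" for x y
      using that
    proof (induction rule: rtranclp_induct)
      case base
      thus ?case by blast
    next
      case (step y z)
      then obtain w where w: "SO\<^sup>*\<^sup>* x w" "\<not> E w"
          "w = y \<or> (\<exists>e. E e \<and> E y \<and> S w e \<and> SE\<^sup>*\<^sup>* e y)"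
        by blast
      show ?case
      proof (cases "E z")
        case True
        have "\<exists>e. E e \<and> E z \<and> S w e \<and> SE\<^sup>*\<^sup>* e z"
        proof (cases "w = y")
          case True
          thus ?thesis using step(2) \<open>E z\<close> by blast
        next
          case False
          then obtain e where "E e" "E y" "S w e" "SE\<^sup>*\<^sup>* e y" using w by blast
          moreover have "SE y z" using step(2) \<open>E z\<close> \<open>E y\<close> by (simp add: SE_def)
          ultimately show ?thesis using \<open>E z\<close> by (meson rtranclp.rtrancl_into_rtrancl)
        qed
        thus ?thesis using w by blast
      next
        case False
        have "SO w z"
          using w False step(2) direct detour by blast
        with w(1) have "SO\<^sup>*\<^sup>* x z"
          by (rule rtranclp.rtrancl_into_rtrancl)
        thus ?thesis using False by blast
      qed
    qed
    have odd_bound: "mdist X x y \<le> \<rho> x / 4" if chain: "S\<^sup>*\<^sup>* x y" "\<not> E x" and "x \<in> mspace X" for x y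
    proof -
      obtain w where w: "SO\<^sup>*\<^sup>* x w" "\<not> E w"
          "w = y \<or> (\<exists>e. E e \<and> E y \<and> S w e \<and> SE\<^sup>*\<^sup>* e y)"
        using from_odd[OF chain] by blast
      have \<rho>: "\<rho> x > 0" using pos that by blast
      have "c\<^sup>2 * \<delta> * \<rho> x = \<rho> x / 168" by (simp add: \<delta>c)
      hence "c * c * \<delta> * \<rho> x = \<rho> x / 168" by (simp only: power2_eq_square)
      moreover have "c * \<delta> * \<rho> x \<le> 1 / 168 * \<rho> x" "\<delta> * \<rho> x \<le> c * \<delta> * \<rho> x"
        using c\<delta> \<delta>1 \<rho> by (intro mult_right_mono; simp)+
      ultimately have sq: "c * c * \<delta> * \<rho> x = \<rho> x / 168" "c * \<delta> * \<rho> x \<le> \<rho> x / 168"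
          "\<delta> * \<rho> x \<le> \<rho> x / 168"
        by linarith+
      have xw: "level (\<rho> w) = level (\<rho> x)" "mdist X x w \<le> 2 * c * \<epsilon> * \<rho> x"
        using odd_chain[OF w(1)] that by auto
      have xw': "mdist X x w \<le> 32 / 168 * \<rho> x"
        using xw(2) sq unfolding \<epsilon>_def by linarith
      show ?thesis
      proof (cases "w = y")
        case True
        thus ?thesis using xw' \<rho> by simp
      next
        case False
        then obtain e where e: "E e" "E y" "S w e" "SE\<^sup>*\<^sup>* e y" using w by blast
        note we = S_D[OF e(3)]
        have wx: "\<rho> w \<le> 2 * \<rho> x" using same_level xw(1) that we by blast
        have ey: "mdist X e y \<le> 2 * c * \<delta> * \<rho> e"
          using even_chain[OF e(4) we(2) e(1)] by blast
        have "2 * c * \<delta> * \<rho> e \<le> 2 * c * \<delta> * (4 * \<rho> x)" "\<delta> * \<rho> w \<le> \<delta> * (2 * \<rho> x)"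
          using we(6,7) wx c1 \<delta> by (intro mult_left_mono; simp)+
        hence 2: "mdist X e y \<le> 8 / 168 * \<rho> x" "mdist X w e \<le> 2 / 168 * \<rho> x"
          using ey we(4) sq by linarith+
        have y: "y \<in> mspace X"
          using that(1,3) unfolding S_def by (rule colour_chain_in_mspace)
        have "mdist X x y \<le> mdist X x w + mdist X w y" "mdist X w y \<le> mdist X w e + mdist X e y"
          using we y that by (auto intro: mdist_triangle)
        thus ?thesis using xw' 2 by linarith
      qed
    qed
    have chain_sym: "S\<^sup>*\<^sup>* y x" if "S\<^sup>*\<^sup>* x y" for x y
      using that unfolding S_def by (rule colour_chain_sym)
    \<comment> \<open>A chain that starts in an even level may visit an odd one; both of its ends are then
      reached from the odd point, to which \<open>odd_bound\<close> applies.\<close>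
    have even_or_odd: "SE\<^sup>*\<^sup>* x y \<or> (\<exists>w. \<not> E w \<and> S\<^sup>*\<^sup>* x w \<and> S\<^sup>*\<^sup>* w y)" if "S\<^sup>*\<^sup>* x y" for x y
      using that
    proof (induction rule: rtranclp_induct)
      case base
      thus ?case by blast
    next
      case (step y z)
      thus ?case
        by (metis SE_def rtranclp.rtrancl_into_rtrancl rtranclp.rtrancl_refl)
    qed
    have "mdist X x y < \<rho> x" if chain: "S\<^sup>*\<^sup>* x y" and x: "x \<in> mspace X" for x y
    proof (cases "\<exists>w. \<not> E w \<and> S\<^sup>*\<^sup>* x w \<and> S\<^sup>*\<^sup>* w y")
      case True
      then obtain w where w: "\<not> E w" "S\<^sup>*\<^sup>* x w" "S\<^sup>*\<^sup>* w y" by blast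
      have ms: "w \<in> mspace X" "y \<in> mspace X"
        using chain w(2) x colour_chain_in_mspace unfolding S_def by metis+
      have "mdist X w x \<le> \<rho> w / 4" "mdist X w y \<le> \<rho> w / 4"
        using odd_bound chain_sym w ms by auto
      moreover have "mdist X x y \<le> mdist X x w + mdist X w y"
        using x ms by (intro mdist_triangle)
      moreover have "\<rho> w \<le> \<rho> x + mdist X w x" using lip x ms by blast
      ultimately show ?thesis using pos[OF x] by (simp add: mdist_commute)
    next
      case False
      hence "E x" "SE\<^sup>*\<^sup>* x y" using chain even_or_odd by blast+
      hence "mdist X x y \<le> 2 * (c * \<delta>) * \<rho> x" using even_chain x by (simp add: mult_ac)
      also have "\<dots> < 1 * \<rho> x"
        using c\<delta> pos[OF x] by (intro mult_strict_right_mono) auto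
      finally show ?thesis by simp
    qed
    moreover have "col x < N" if "x \<in> mspace X" for x
      using \<kappa> that by (auto simp: col_def chain_bounded_colouring_def)
    ultimately show ?thesis unfolding S_def by blast
  qed
  with \<delta> show ?thesis by (rule that)
qed

section \<open>Quasisymmetric maps\<close>

text \<open>The weak form of quasisymmetry that passes to the inverse map: small ratios of distances go
  to small ratios. For a quasisymmetric map it says that \<open>\<eta> t\<close> can be made arbitrarily small with
  \<open>t > 0\<close>; for the inverse it comes from the finiteness of \<open>\<eta>\<close> at large arguments.\<close>

definition vanishing_distortion :: "'a metric \<Rightarrow> 'b metric \<Rightarrow> ('a \<Rightarrow> 'b) \<Rightarrow> bool" where
  "vanishing_distortion X Y f \<longleftrightarrow>
     (\<forall>u>0. \<exists>t>0. \<forall>x\<in>mspace X. \<forall>x'\<in>mspace X. \<forall>z\<in>mspace X.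
        mdist X x z \<le> t * mdist X x' z \<longrightarrow> mdist Y (f x) (f z) \<le> u * mdist Y (f x') (f z))"

lemma quasisymmetric_vanishing_distortion:
  assumes "quasisymmetric X Y f"
  shows "vanishing_distortion X Y f"
  unfolding vanishing_distortion_def
proof (intro allI impI)
  fix u :: real assume u: "u > 0"
  obtain \<eta> :: "real \<Rightarrow> real"
    where \<eta>: "homeomorphic_map (top_of_set {0..}) (top_of_set {0..}) \<eta>"
      and qs: "\<forall>x \<in> mspace X. \<forall>x' \<in> mspace X. \<forall>z \<in> mspace X. \<forall>t>0.
           mdist X x z \<le> t * mdist X x' z \<longrightarrow>
           mdist Y (f x) (f z) \<le> \<eta> t * mdist Y (f x') (f z)"
    using assms unfolding quasisymmetric_def by blast
  have surj: "\<eta> ` {0..} = {0..}"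
    using homeomorphic_imp_surjective_map[OF \<eta>] by simp
  \<comment> \<open>A value of \<open>\<eta>\<close> in \<open>{0..u}\<close> other than \<open>\<eta> 0\<close> is attained at some \<open>t > 0\<close>.\<close>
  define v where "v = (if \<eta> 0 = u then u / 2 else u)"
  have v: "0 \<le> v" "v \<le> u" "v \<noteq> \<eta> 0" using u by (auto simp: v_def)
  then obtain t where t: "0 \<le> t" "\<eta> t = v" using surj by (metis atLeast_iff imageE)
  hence "t > 0" using v by (metis order_le_less)
  moreover have "v * mdist Y a b \<le> u * mdist Y a b" for a b
    using v by (intro mult_right_mono) auto
  ultimately show "\<exists>t>0. \<forall>x\<in>mspace X. \<forall>x'\<in>mspace X. \<forall>z\<in>mspace X.
        mdist X x z \<le> t * mdist X x' z \<longrightarrow> mdist Y (f x) (f z) \<le> u * mdist Y (f x') (f z)"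
    using qs t(2) by (meson order_trans)
qed

text \<open>If a ratio of distances in \<open>X\<close> exceeds \<open>u\<close>, its reciprocal is below \<open>1 / u\<close>, so the reciprocal of
  the ratio of the image distances is at most \<open>\<eta> (1 / u)\<close>: the image ratio cannot be small.\<close>

lemma quasisymmetric_inverse_vanishing_distortion:
  assumes qs: "quasisymmetric X Y f"
    and bij: "bij_betw f (mspace X) (mspace Y)"
  shows "vanishing_distortion Y X (the_inv_into (mspace X) f)"
  unfolding vanishing_distortion_def
proof (intro allI impI)
  fix u :: real assume u: "u > 0"
  define g where "g = the_inv_into (mspace X) f"
  have inj: "inj_on f (mspace X)" using bij by (simp add: bij_betw_def)
  have g: "g y \<in> mspace X" "f (g y) = y" if "y \<in> mspace Y" for y
    using that bij inj unfolding g_def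
    by (auto simp: bij_betw_def f_the_inv_into_f intro: the_inv_into_into)
  obtain \<eta> :: "real \<Rightarrow> real"
    where \<eta>: "\<forall>x \<in> mspace X. \<forall>x' \<in> mspace X. \<forall>z \<in> mspace X. \<forall>t>0.
           mdist X x z \<le> t * mdist X x' z \<longrightarrow>
           mdist Y (f x) (f z) \<le> \<eta> t * mdist Y (f x') (f z)"
    using qs unfolding quasisymmetric_def by blast
  define A where "A = max 1 (\<eta> (1 / u))"
  have A: "A > 0" by (simp add: A_def)
  define t where "t = 1 / (2 * A)"
  have t: "t > 0" using A by (simp add: t_def)
  have "mdist X (g x) (g z) \<le> u * mdist X (g x') (g z)"
    if ms: "x \<in> mspace Y" "x' \<in> mspace Y" "z \<in> mspace Y" and le: "mdist Y x z \<le> t * mdist Y x' z"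
    for x x' z
  proof (rule ccontr)
    assume neg: "\<not> ?thesis"
    hence "mdist X (g x') (g z) \<le> 1 / u * mdist X (g x) (g z)"
      using u by (simp add: field_simps)
    hence "mdist Y x' z \<le> \<eta> (1 / u) * mdist Y x z"
      using \<eta> g ms u by (metis zero_less_divide_1_iff)
    also have "\<dots> \<le> A * mdist Y x z"
      by (intro mult_right_mono) (auto simp: A_def)
    also have "\<dots> \<le> A * (t * mdist Y x' z)"
      using le A by (intro mult_left_mono) auto
    also have "\<dots> = mdist Y x' z / 2" using A by (simp add: t_def)
    finally have "mdist Y x' z = 0" using mdist_nonneg[of Y x' z] by linarith
    hence "mdist Y x z = 0" using le mdist_nonneg[of Y x z] by simp
    hence "x = z" using ms by simp
    hence "mdist X (g x) (g z) = 0" using g ms by simp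
    thus False using neg u by simp
  qed
  thus "\<exists>t>0. \<forall>x\<in>mspace Y. \<forall>x'\<in>mspace Y. \<forall>z\<in>mspace Y. mdist Y x z \<le> t * mdist Y x' z \<longrightarrow>
      mdist X (the_inv_into (mspace X) f x) (the_inv_into (mspace X) f z)
        \<le> u * mdist X (the_inv_into (mspace X) f x') (the_inv_into (mspace X) f z)"
    using t unfolding g_def by blast
qed

text \<open>The scale at \<open>x\<close> is the infimal radius of a ball around \<open>x\<close> whose image contains two points
  more than \<open>s\<close> apart. As an infimum of maxima of distances to \<open>x\<close> it is 1-Lipschitz. Comparing
  images with \<open>f x\<close> alone would give a function that can drop sharply between nearby points when
  \<open>Y\<close> has large gaps. In the last property, one of two points that nearly realise the infimum
  has image more than \<open>s / 2\<close> away from \<open>f x\<close>.\<close>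

lemma image_scale_exists:
  assumes f: "f \<in> mspace X \<rightarrow> mspace Y" and vf: "vanishing_distortion X Y f"
    and s: "s > 0"
    and far: "\<exists>y\<in>mspace X. \<exists>z\<in>mspace X. mdist Y (f y) (f z) > s"
  obtains \<rho> where "\<And>x. x \<in> mspace X \<Longrightarrow> \<rho> x > 0"
    "\<And>x y. x \<in> mspace X \<Longrightarrow> y \<in> mspace X \<Longrightarrow> \<rho> x \<le> \<rho> y + mdist X x y"
    "\<And>x y. x \<in> mspace X \<Longrightarrow> y \<in> mspace X \<Longrightarrow> mdist X x y < \<rho> x \<Longrightarrow> mdist Y (f x) (f y) \<le> s"
    "\<And>x. x \<in> mspace X \<Longrightarrow> \<exists>w\<in>mspace X. mdist X x w \<le> 2 * \<rho> x \<and> mdist Y (f x) (f w) > s / 2"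
proof -
  define P where "P = {(y, z). y \<in> mspace X \<and> z \<in> mspace X \<and> mdist Y (f y) (f z) > s}"
  define h where "h x = (\<lambda>(y, z). max (mdist X x y) (mdist X x z))" for x
  define \<rho> where "\<rho> x = (INF p\<in>P. h x p)" for x
  have P: "P \<noteq> {}" using far by (auto simp: P_def)
  have h0: "0 \<le> h x p" for x p by (auto simp: h_def split: prod.split intro: max.coboundedI1)
  have bdd: "bdd_below (h x ` P)" for x
    using h0 by (intro bdd_belowI2[of _ 0]) auto
  have \<rho>_le: "\<rho> x \<le> h x p" if "p \<in> P" for x p
    unfolding \<rho>_def using bdd that by (intro cINF_lower)
  have half: "mdist Y (f x) (f y) > s / 2 \<or> mdist Y (f x) (f z) > s / 2"
    if "(y, z) \<in> P" "x \<in> mspace X" for x y z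
  proof -
    have "mdist Y (f y) (f z) \<le> mdist Y (f y) (f x) + mdist Y (f x) (f z)"
      using that f by (intro mdist_triangle) (auto simp: P_def)
    thus ?thesis using that by (auto simp: P_def mdist_commute)
  qed
  have pos: "\<rho> x > 0" if x: "x \<in> mspace X" for x
  proof -
    obtain a b where ab: "(a, b) \<in> P" using P by fastforce
    obtain y where y: "y \<in> mspace X" "mdist Y (f x) (f y) > s / 2"
      using half[OF ab x] ab by (auto simp: P_def)
    define D where "D = mdist Y (f x) (f y)"
    have D: "D > 0" using y s by (simp add: D_def)
    then obtain t where t: "t > 0" "\<And>z. z \<in> mspace X \<Longrightarrow> mdist X z x \<le> t * mdist X y x \<Longrightarrow>
        mdist Y (f z) (f x) \<le> (s / 2 / D) * mdist Y (f y) (f x)"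
      using vf x y s unfolding vanishing_distortion_def
      by (metis divide_pos_pos half_gt_zero)
    have "(s / 2 / D) * mdist Y (f y) (f x) = s / 2"
      using D by (simp add: D_def mdist_commute)
    hence near: "mdist Y (f x) (f z) \<le> s / 2"
      if "z \<in> mspace X" "mdist X x z \<le> t * mdist X y x" for z
      using t(2)[of z] that by (metis mdist_commute)
    have "f x \<in> mspace Y" using f x by auto
    hence "mdist Y (f x) (f x) = 0" by simp
    hence "x \<noteq> y" using D by (auto simp: D_def)
    hence "mdist X y x \<noteq> 0" using x y by simp
    hence "mdist X y x > 0" using mdist_nonneg[of X y x] by linarith
    hence "t * mdist X y x > 0" using t by simp
    moreover have "t * mdist X y x \<le> \<rho> x"
      unfolding \<rho>_def
    proof (intro cINF_greatest[OF P])
      fix p assume p: "p \<in> P"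
      obtain a b where ab: "p = (a, b)" by (cases p)
      thus "t * mdist X y x \<le> h x p"
        using half[of a b x] near[of a] near[of b] p x by (fastforce simp: h_def P_def)
    qed
    ultimately show ?thesis by simp
  qed
  show ?thesis
  proof (rule that)
    fix x y assume xy: "x \<in> mspace X" "y \<in> mspace X"
    have "\<rho> x - mdist X x y \<le> h y p" if p: "p \<in> P" for p
    proof -
      obtain a b where ab: "p = (a, b)" "a \<in> mspace X" "b \<in> mspace X"
        using p by (auto simp: P_def)
      have "mdist X x a \<le> mdist X x y + mdist X y a" "mdist X x b \<le> mdist X x y + mdist X y b"
        using ab xy by (auto intro: mdist_triangle)
      thus ?thesis using \<rho>_le[OF p, of x] ab by (auto simp: h_def)
    qed
    hence "\<rho> x - mdist X x y \<le> \<rho> y"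
      unfolding \<rho>_def[of y] by (intro cINF_greatest[OF P])
    thus "\<rho> x \<le> \<rho> y + mdist X x y" by simp
  next
    fix x y assume xy: "x \<in> mspace X" "y \<in> mspace X" "mdist X x y < \<rho> x"
    show "mdist Y (f x) (f y) \<le> s"
    proof (rule ccontr)
      assume "\<not> ?thesis"
      hence "(x, y) \<in> P" using xy by (simp add: P_def)
      from \<rho>_le[OF this, of x] have "\<rho> x \<le> max (mdist X x x) (mdist X x y)"
        by (simp add: h_def)
      moreover have "mdist X x x = 0" using xy by simp
      ultimately show False using xy(3) mdist_nonneg[of X x y] by linarith
    qed
  next
    fix x assume x: "x \<in> mspace X"
    have "\<rho> x < 2 * \<rho> x" using pos[OF x] by simp
    then obtain a b where ab: "(a, b) \<in> P" "h x (a, b) < 2 * \<rho> x"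
      unfolding \<rho>_def[of x] using cINF_less_iff[OF P bdd, of x] by fastforce
    thus "\<exists>w\<in>mspace X. mdist X x w \<le> 2 * \<rho> x \<and> mdist Y (f x) (f w) > s / 2"
      using half[OF ab(1) x] unfolding h_def P_def by (auto intro: less_imp_le)
  qed (fact pos)
qed

text \<open>Here \<open>\<rho>\<close> is used from both sides. Points within \<open>\<rho> x\<close> of \<open>x\<close> have images within \<open>s\<close>. Conversely,
  some \<open>w\<close> within \<open>2 * \<rho> x\<close> has its image at least \<open>s / 2\<close> away; a point of \<open>Y\<close> much closer than that
  to \<open>f x\<close> comes, by the distortion bound for the inverse, from a point within \<open>\<delta> * \<rho> x\<close>.\<close>

lemma linearly_colourable_transfer:
  assumes X: "linearly_colourable X N"
    and bij: "bij_betw f (mspace X) (mspace Y)"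
    and g: "\<And>x. x \<in> mspace X \<Longrightarrow> g (f x) = x"
    and vf: "vanishing_distortion X Y f" and vg: "vanishing_distortion Y X g"
  shows "linearly_colourable Y N"
proof -
  have Y: "mspace Y = f ` mspace X"
    using bij by (simp add: bij_betw_def)
  have f: "f \<in> mspace X \<rightarrow> mspace Y" and gY: "\<And>y. y \<in> mspace Y \<Longrightarrow> g y \<in> mspace X \<and> f (g y) = y"
    using g by (auto simp: Y)
  from X obtain \<delta> where \<delta>: "\<delta> > 0"
    "\<And>\<rho>. (\<And>x. x \<in> mspace X \<Longrightarrow> \<rho> x > 0) \<Longrightarrow>
      (\<And>x y. x \<in> mspace X \<Longrightarrow> y \<in> mspace X \<Longrightarrow> \<rho> x \<le> \<rho> y + mdist X x y) \<Longrightarrow>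
      \<exists>col. (\<forall>x\<in>mspace X. col x < N) \<and>
        (\<forall>x\<in>mspace X. \<forall>y. (colour_step X col (\<lambda>x. \<delta> * \<rho> x))\<^sup>*\<^sup>* x y \<longrightarrow> mdist X x y < \<rho> x)"
    using variable_scale_colouring by blast
  obtain t where t: "t > 0" "\<And>x x' z. x \<in> mspace Y \<Longrightarrow> x' \<in> mspace Y \<Longrightarrow> z \<in> mspace Y \<Longrightarrow>
      mdist Y x z \<le> t * mdist Y x' z \<Longrightarrow> mdist X (g x) (g z) \<le> (\<delta> / 2) * mdist X (g x') (g z)"
    using vg \<delta>(1) unfolding vanishing_distortion_def by (metis half_gt_zero)
  have "\<exists>col. chain_bounded_colouring Y N (2 / t * r) r col" if r: "r > 0" for r
  proof (cases "\<exists>y\<in>mspace X. \<exists>z\<in>mspace X. mdist Y (f y) (f z) > 2 / t * r")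
    case False
    \<comment> \<open>The space \<open>Y\<close> is itself a set of diameter at most the required bound, and any colouring will do.\<close>
    obtain col where "\<forall>x\<in>mspace X. col x < N"
      using \<delta>(2)[of "\<lambda>_. 1"] by auto
    moreover have "mdist Y x y \<le> 2 / t * r" if "x \<in> mspace Y" "y \<in> mspace Y" for x y
      using False gY that by (metis not_less)
    ultimately have "chain_bounded_colouring Y N (2 / t * r) r (\<lambda>y. col (g y))"
      unfolding chain_bounded_colouring_def using gY colour_chain_in_mspace by metis
    thus ?thesis by blast
  next
    case True
    define s where "s = 2 / t * r"
    have s: "s > 0" "r = t * (s / 2)" using t(1) r by (auto simp: s_def)
    from image_scale_exists[OF f vf s(1)] True obtain \<rho> where
      \<rho>: "\<And>x. x \<in> mspace X \<Longrightarrow> \<rho> x > 0"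
        "\<And>x y. x \<in> mspace X \<Longrightarrow> y \<in> mspace X \<Longrightarrow> \<rho> x \<le> \<rho> y + mdist X x y"
      and small: "\<And>x y. x \<in> mspace X \<Longrightarrow> y \<in> mspace X \<Longrightarrow> mdist X x y < \<rho> x \<Longrightarrow>
        mdist Y (f x) (f y) \<le> s"
      and far: "\<And>x. x \<in> mspace X \<Longrightarrow>
        \<exists>w\<in>mspace X. mdist X x w \<le> 2 * \<rho> x \<and> mdist Y (f x) (f w) > s / 2"
      unfolding s_def by blast
    obtain col where col: "\<forall>x\<in>mspace X. col x < N"
        "\<forall>x\<in>mspace X. \<forall>y. (colour_step X col (\<lambda>x. \<delta> * \<rho> x))\<^sup>*\<^sup>* x y \<longrightarrow> mdist X x y < \<rho> x"
      using \<delta>(2)[of \<rho>] \<rho> by blast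
    have near: "mdist X (g y) (g z) \<le> \<delta> * \<rho> (g z)"
      if yz: "y \<in> mspace Y" "z \<in> mspace Y" "mdist Y y z \<le> r" for y z
    proof -
      obtain w where w: "w \<in> mspace X" "mdist X (g z) w \<le> 2 * \<rho> (g z)" "mdist Y z (f w) > s / 2"
        using far[of "g z"] gY yz by auto
      have "r \<le> t * mdist Y (f w) z"
        unfolding s(2) using w t(1) by (intro mult_left_mono) (auto simp: mdist_commute)
      hence "mdist X (g y) (g z) \<le> (\<delta> / 2) * mdist X (g (f w)) (g z)"
        using yz w f by (intro t) auto
      also have "\<dots> \<le> (\<delta> / 2) * (2 * \<rho> (g z))"
        using w g \<delta>(1) by (intro mult_left_mono) (auto simp: mdist_commute)
      finally show ?thesis by simp
    qed
    have step: "colour_step X col (\<lambda>x. \<delta> * \<rho> x) (g y) (g z)"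
      if "colour_step Y (\<lambda>y. col (g y)) (\<lambda>_. r) y z" for y z
      using that near[of y z] near[of z y] gY by (auto simp: colour_step_def mdist_commute)
    have "mdist Y y z \<le> s"
      if y: "y \<in> mspace Y" and chain: "(colour_step Y (\<lambda>y. col (g y)) (\<lambda>_. r))\<^sup>*\<^sup>* y z" for y z
    proof -
      have "(colour_step X col (\<lambda>x. \<delta> * \<rho> x))\<^sup>*\<^sup>* (g y) (g z)"
        using chain by (induction rule: rtranclp_induct) (auto intro: rtranclp.rtrancl_into_rtrancl step)
      hence "mdist X (g y) (g z) < \<rho> (g y)" using col y gY by blast
      moreover have "z \<in> mspace Y" using colour_chain_in_mspace chain y by metis
      ultimately show ?thesis using small[of "g y" "g z"] gY y by auto
    qed
    hence "chain_bounded_colouring Y N s r (\<lambda>y. col (g y))"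
      using col(1) gY by (auto simp: chain_bounded_colouring_def)
    thus ?thesis unfolding s_def by blast
  qed
  moreover have "2 / t > 0" using t by simp
  ultimately show ?thesis unfolding linearly_colourable_def by blast
qed

theorem theorem1p2:
  fixes X :: "'a metric" and Y :: "'b metric" and f :: "'a \<Rightarrow> 'b"
  assumes "quasisymmetric X Y f"
    and "homeomorphic_map (mtopology_of X) (mtopology_of Y) f"
  shows "nagata_dim X = nagata_dim Y"
proof -
  define g where "g = the_inv_into (mspace X) f"
  have bij: "bij_betw f (mspace X) (mspace Y)"
    using assms homeomorphic_imp_surjective_map[OF assms(2)]
    by (simp add: bij_betw_def quasisymmetric_def)
  have bij': "bij_betw g (mspace Y) (mspace X)"
    unfolding g_def using bij by (rule bij_betw_the_inv_into)
  have gf: "g (f x) = x" if "x \<in> mspace X" for x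
    using bij that by (simp add: g_def bij_betw_def the_inv_into_f_f)
  have fg: "f (g y) = y" if "y \<in> mspace Y" for y
    using bij that by (auto simp: g_def bij_betw_def f_the_inv_into_f)
  have vf: "vanishing_distortion X Y f"
    using assms(1) by (rule quasisymmetric_vanishing_distortion)
  have vg: "vanishing_distortion Y X g"
    unfolding g_def using assms(1) bij by (rule quasisymmetric_inverse_vanishing_distortion)
  have "linearly_colourable X N \<longleftrightarrow> linearly_colourable Y N" for N
    using linearly_colourable_transfer[OF _ bij gf vf vg]
      linearly_colourable_transfer[OF _ bij' fg vg vf] by blast
  hence "nagata_property X n \<longleftrightarrow> nagata_property Y n" for n
    by (simp add: nagata_property_iff)
  thus ?thesis
    by (simp add: nagata_dim_def)
qed

end
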